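(* Let $A,B,C$ be $n\times n$ complex Hermitian matrices, where $A$ and $B$ are co-diagonal. Then the following are equivalent: (i) $\lambda^\downarrow(aA+B)\prec_w\lambda^\downarrow(aA+C)$ for all real $a\ge 0$; (ii) $\delta(B;A)\prec_w\delta(C;A)$; (iii) $\delta(aA+B;A)\prec_w\delta(aA+C;A)$ for all real $a\ge0$.
   Context: For an $n\times n$ Hermitian matrix $X$, $\lambda^\downarrow(X)=(\lambda_1^\downarrow(X),\dots,\lambda_n^\downarrow(X))$ is the vector of its eigenvalues, counted with multiplicity, in non-increasing order. Hermitian matrices $A$ and $B$ are called co-diagonal if they commute and there is a common orthonormal basis in which both are diagonal and in which the diagonal entries of $A$ and the diagonal entries of $B$ both appear in non-increasing order. For vectors $x,y\in\mathbb{R}^n$, $x\prec_w y$ means $\sum_{j=1}^k x_j\le\sum_{j=1}^k y_j$ for all $k=1,\dots,n$, with no rearrangement of the entries. For Hermitian $X,A$ the vector $\delta(X;A)=(\delta_1(X;A),\dots,\delta_n(X;A))\in\mathbb{R}^n$ is defined by requiring, for all $k=1,\dots,n$, $$\sum_{j=1}^k \delta_j(X;A) = \lim_{t\to 0^+}\frac1t\sum_{j=1}^k\left(\lambda_j^\downarrow(A+tX)-\lambda_j^\downarrow(A)\right)$$ (the one-sided directional derivative at $A$ in direction $X$ of the sum of the $k$ largest eigenvalues, which is a convex function, so the limit exists). *)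

theory Defs
  imports
    "HOL-Computational_Algebra.Polynomial"
    "Jordan_Normal_Form.Char_Poly"
    "Jordan_Normal_Form.Schur_Decomposition"
begin

definition hermitian_mat :: "complex mat \<Rightarrow> bool" where
  "hermitian_mat A \<longleftrightarrow> mat_adjoint A = A"

definition unitary_mat :: "complex mat \<Rightarrow> bool" where
  "unitary_mat U \<longleftrightarrow> square_mat U \<and> mat_adjoint U * U = 1\<^sub>m (dim_row U)"

(* The multiset proots (char_poly A) lists the eigenvalues with multiplicity.
   Re only changes the type from complex to real when A is Hermitian. *)
definition eigvals_desc :: "complex mat \<Rightarrow> real vec" where
  "eigvals_desc A =
     vec_of_list (rev (sorted_list_of_multiset (image_mset Re (proots (char_poly A)))))"

(* The columns of U are the common orthonormal basis. For Hermitian M the diagonal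
   entries of mat_adjoint U * M * U are real, so comparing real parts compares them. *)
definition diagonal_desc_in :: "complex mat \<Rightarrow> complex mat \<Rightarrow> bool" where
  "diagonal_desc_in U M \<longleftrightarrow>
     (let D = mat_adjoint U * M * U in
        diagonal_mat D \<and>
        (\<forall>i j. i \<le> j \<and> j < dim_row D \<longrightarrow> Re (D $$ (j, j)) \<le> Re (D $$ (i, i))))"

definition co_diagonal :: "complex mat \<Rightarrow> complex mat \<Rightarrow> bool" where
  "co_diagonal A B \<longleftrightarrow>
     A * B = B * A \<and>
     (\<exists>U \<in> carrier_mat (dim_row A) (dim_row A).
        unitary_mat U \<and> diagonal_desc_in U A \<and> diagonal_desc_in U B)"

(* Unlike the usual weak majorization, the entries are not rearranged.
   Vectors are indexed from 0, so the first k entries are those with index j < k. *)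
definition weakly_majorized :: "real vec \<Rightarrow> real vec \<Rightarrow> bool" (infix "\<prec>\<^sub>w" 50) where
  "x \<prec>\<^sub>w y \<longleftrightarrow>
     dim_vec x = dim_vec y \<and>
     (\<forall>k \<in> {1..dim_vec x}. (\<Sum>j<k. x $ j) \<le> (\<Sum>j<k. y $ j))"

definition is_delta :: "complex mat \<Rightarrow> complex mat \<Rightarrow> real vec \<Rightarrow> bool" where
  "is_delta X A d \<longleftrightarrow>
     d \<in> carrier_vec (dim_row A) \<and>
     (\<forall>k \<in> {1..dim_row A}.
        ((\<lambda>t::real. (1 / t) *
            (\<Sum>j<k. eigvals_desc (A + complex_of_real t \<cdot>\<^sub>m X) $ j - eigvals_desc A $ j))
          \<longlongrightarrow> (\<Sum>j<k. d $ j)) (at_right 0))"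

(* The prefix sums determine d, so is_delta X A has at most one solution; it has one
   for Hermitian X and A of the same size, by convexity of the sum of the k largest
   eigenvalues. *)
definition delta :: "complex mat \<Rightarrow> complex mat \<Rightarrow> real vec" where
  "delta X A = (THE d. is_delta X A d)"

end

(* Let S_k(X) be the sum of the k largest eigenvalues of X. By Ky Fan's maximum principle S_k is
   subadditive and positively homogeneous, so (S_k(A + tX) - S_k(A)) / t is nondecreasing in t > 0
   and bounded, above by S_k(X). Its limit at 0+ is the k-th partial sum D_k(X) of delta(X; A), and
   D_k(aA + X) = a S_k(A) + D_k(X), which gives (ii) <-> (iii). The upper bound for X = aA + C reads
   a S_k(A) + D_k(C) <= S_k(aA + C), with equality for B in place of C because a common ordered
   eigenbasis makes S_k additive on the cone of A and B; this is (ii) -> (i). Conversely (i) with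
   a = 1/t compares the difference quotients of B and C, and t -> 0+ gives (ii). *)
theory Submission
  imports Defs
begin

section \<open>Adjoints, Hermitian matrices and unitary matrices\<close>

lemma mat_adjoint_carrier [simp]: "A \<in> carrier_mat m n \<Longrightarrow> mat_adjoint A \<in> carrier_mat n m"
  by (auto simp: mat_adjoint_def)

lemma dim_mat_adjoint [simp]: "dim_row (mat_adjoint A) = dim_col A" "dim_col (mat_adjoint A) = dim_row A"
  by (auto simp: mat_adjoint_def)

lemma index_mat_adjoint [simp]:
  fixes A :: "complex mat"
  assumes "i < dim_col A" "j < dim_row A"
  shows "mat_adjoint A $$ (i, j) = cnj (A $$ (j, i))"
  using assms by (simp add: mat_adjoint_def mat_of_rows_index)

lemma mat_adjoint_adjoint [simp]: "mat_adjoint (mat_adjoint A) = (A :: complex mat)"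
  by (rule eq_matI) auto

lemma mat_adjoint_mult:
  fixes A B :: "complex mat"
  assumes "A \<in> carrier_mat l m" "B \<in> carrier_mat m n"
  shows "mat_adjoint (A * B) = mat_adjoint B * mat_adjoint A"
  using assms by (intro eq_matI) (auto simp: scalar_prod_def mult.commute intro!: sum.cong)

lemma mat_adjoint_four_block_diag:
  fixes A D :: "complex mat"
  assumes "A \<in> carrier_mat k k" "D \<in> carrier_mat l l"
  shows "mat_adjoint (four_block_mat A (0\<^sub>m k l) (0\<^sub>m l k) D) =
    four_block_mat (mat_adjoint A) (0\<^sub>m k l) (0\<^sub>m l k) (mat_adjoint D)"
  using assms by (intro eq_matI) auto

lemma hermitian_mat_index:
  assumes "hermitian_mat A" "A \<in> carrier_mat n n" "i < n" "j < n"
  shows "cnj (A $$ (i, j)) = A $$ (j, i)"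
proof -
  have "mat_adjoint A $$ (j, i) = A $$ (j, i)"
    using assms by (simp add: hermitian_mat_def)
  then show ?thesis using assms by simp
qed

lemma hermitian_matI:
  assumes "A \<in> carrier_mat n n" "\<And>i j. i < n \<Longrightarrow> j < n \<Longrightarrow> cnj (A $$ (i, j)) = A $$ (j, i)"
  shows "hermitian_mat A"
  unfolding hermitian_mat_def using assms by (intro eq_matI) auto

lemma hermitian_mat_add:
  assumes "A \<in> carrier_mat n n" "B \<in> carrier_mat n n" "hermitian_mat A" "hermitian_mat B"
  shows "hermitian_mat (A + B)"
proof (rule hermitian_matI)
  fix i j assume ij: "i < n" "j < n"
  show "cnj ((A + B) $$ (i, j)) = (A + B) $$ (j, i)"
    using assms ij hermitian_mat_index[OF assms(3,1) ij] hermitian_mat_index[OF assms(4,2) ij]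
    by simp
qed (use assms in auto)

lemma hermitian_mat_smult:
  assumes "A \<in> carrier_mat n n" "hermitian_mat A"
  shows "hermitian_mat (complex_of_real c \<cdot>\<^sub>m A)"
proof (rule hermitian_matI)
  fix i j assume ij: "i < n" "j < n"
  show "cnj ((complex_of_real c \<cdot>\<^sub>m A) $$ (i, j)) = (complex_of_real c \<cdot>\<^sub>m A) $$ (j, i)"
    using assms ij hermitian_mat_index[OF assms(2,1) ij] by simp
qed (use assms in auto)

lemma hermitian_mat_conj:
  assumes "A \<in> carrier_mat n n" "U \<in> carrier_mat n m" "hermitian_mat A"
  shows "hermitian_mat (mat_adjoint U * A * U)"
proof -
  have "mat_adjoint U * A \<in> carrier_mat m n" using assms by auto
  then have "mat_adjoint (mat_adjoint U * A * U) = mat_adjoint U * (mat_adjoint A * U)"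
    using assms by (simp add: mat_adjoint_mult[of _ m n _ m] mat_adjoint_mult[of _ m n _ n])
  then show ?thesis
    using assms by (simp add: hermitian_mat_def assoc_mult_mat[of _ m n _ n _ m])
qed

lemma unitary_matD:
  assumes "unitary_mat U" "U \<in> carrier_mat n n"
  shows "mat_adjoint U * U = 1\<^sub>m n" "U * mat_adjoint U = 1\<^sub>m n"
proof -
  show *: "mat_adjoint U * U = 1\<^sub>m n" using assms by (simp add: unitary_mat_def)
  show "U * mat_adjoint U = 1\<^sub>m n"
    by (rule mat_mult_left_right_inverse[OF _ _ *]) (use assms in auto)
qed

lemma unitary_matI: "U \<in> carrier_mat n n \<Longrightarrow> mat_adjoint U * U = 1\<^sub>m n \<Longrightarrow> unitary_mat U"
  by (auto simp: unitary_mat_def)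

lemma unitary_mat_mult:
  assumes "unitary_mat U" "U \<in> carrier_mat n n" "unitary_mat V" "V \<in> carrier_mat n n"
  shows "unitary_mat (U * V)"
proof (rule unitary_matI[of _ n])
  have "mat_adjoint (U * V) * (U * V) = mat_adjoint V * ((mat_adjoint U * U) * V)"
    using assms by (simp add: mat_adjoint_mult[of _ n n _ n] assoc_mult_mat[of _ n n _ n _ n])
  then show "mat_adjoint (U * V) * (U * V) = 1\<^sub>m n"
    using assms by (simp add: unitary_matD)
qed (use assms in auto)

lemma unitary_mat_adjoint:
  assumes "unitary_mat U" "U \<in> carrier_mat n n"
  shows "unitary_mat (mat_adjoint U)"
  using assms by (intro unitary_matI[of _ n]) (auto simp: unitary_matD)

lemma unitary_conj_mult:
  fixes A U V :: "complex mat"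
  assumes "A \<in> carrier_mat n n" "U \<in> carrier_mat n n" "V \<in> carrier_mat n n"
  shows "mat_adjoint (U * V) * A * (U * V) = mat_adjoint V * (mat_adjoint U * A * U) * V"
proof -
  have c: "mat_adjoint U \<in> carrier_mat n n" "mat_adjoint V \<in> carrier_mat n n" "A * U \<in> carrier_mat n n"
    "mat_adjoint U * A \<in> carrier_mat n n"
    "U * V \<in> carrier_mat n n" "A * (U * V) \<in> carrier_mat n n"
    "mat_adjoint U * (A * U) \<in> carrier_mat n n"
    using assms by (auto intro!: mult_carrier_mat[of _ n n])
  show ?thesis
    unfolding mat_adjoint_mult[OF assms(2,3)]
    by (simp add: assoc_mult_mat[of _ n n _ n _ n] c assms)
qed

section \<open>The spectral theorem with a prescribed order of the eigenvalues\<close>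

text \<open>Complete \<open>v\<close> to a basis, orthogonalise by Gram-Schmidt, which keeps the
  first vector, and normalise. Normalisation is why column 0 is only a multiple of
  \<open>v\<close>.\<close>

lemma unitary_mat_first_col:
  fixes v :: "complex vec"
  assumes v: "v \<in> carrier_vec n" and v0: "v \<noteq> 0\<^sub>v n"
  obtains U c where "U \<in> carrier_mat n n" "unitary_mat U" "col U 0 = c \<cdot>\<^sub>v v"
proof -
  interpret cof_vec_space n "TYPE(complex)" .
  define b where "b = basis_completion v"
  define ws where "ws = gram_schmidt n b"
  note bc = basis_completion[OF v v0, folded b_def]
  have n: "n \<noteq> 0" using v v0 by auto
  then obtain vs where bv: "b = v # vs" using bc(6,7) by (cases b) auto
  have ws: "set ws \<subseteq> carrier_vec n" "corthogonal ws" "length ws = n"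
    using gram_schmidt_result[OF bc(2,4,5) refl, folded ws_def] bc(6) by auto
  have hdws: "ws ! 0 = v"
    using gram_schmidt_hd[OF v, of vs] ws(3) n unfolding ws_def bv
    by (metis hd_conv_nth length_0_conv)
  \<comment> \<open>\<open>c i\<close> is the reciprocal of the norm of \<open>ws ! i\<close>. As an
    embedded real it is fixed by conjugation and can be pulled out of either argument of the inner
    product.\<close>
  define c where "c i = complex_of_real (1 / sqrt (Re (ws ! i \<bullet>c ws ! i)))" for i
  define U where "U = mat_of_cols n (map (\<lambda>i. c i \<cdot>\<^sub>v ws ! i) [0..<n])"
  have wsc: "ws ! i \<in> carrier_vec n" if "i < n" for i using ws that by auto
  have cnjc: "cnj (c i) = c i" for i by (simp add: c_def)
  have U: "U \<in> carrier_mat n n" by (auto simp: U_def)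
  have colU: "col U i = c i \<cdot>\<^sub>v ws ! i" if "i < n" for i
    using that wsc[OF that] by (simp add: U_def)
  have "mat_adjoint U * U = 1\<^sub>m n"
  proof (rule eq_matI)
    fix i j assume "i < dim_row (1\<^sub>m n :: complex mat)" "j < dim_col (1\<^sub>m n :: complex mat)"
    then have ij: "i < n" "j < n" by auto
    have "(mat_adjoint U * U) $$ (i, j) = col U j \<bullet>c col U i"
      using U ij by (auto simp: scalar_prod_def mult.commute intro!: sum.cong)
    also have "\<dots> = c i * c j * (ws ! j \<bullet>c ws ! i)"
      using wsc[OF ij(1)] wsc[OF ij(2)] ij
      by (auto simp: colU scalar_prod_def sum_distrib_left cnjc algebra_simps intro!: sum.cong)
    also have "\<dots> = 1\<^sub>m n $$ (i, j)"
    proof (cases "i = j")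
      case False
      then show ?thesis using corthogonalD[OF ws(2)] ij ws(3) by simp
    next
      case True
      have "ws ! i \<bullet>c ws ! i \<noteq> 0" using corthogonalD[OF ws(2)] ij ws(3) by auto
      \<comment> \<open>In the order on complex numbers, nonnegativity includes being real, so the
        nonzero squared norm is a positive real.\<close>
      moreover have "ws ! i \<bullet>c ws ! i \<ge> 0" by (rule conjugate_square_ge_0_vec)
      ultimately have "ws ! i \<bullet>c ws ! i = complex_of_real (Re (ws ! i \<bullet>c ws ! i))"
        and "Re (ws ! i \<bullet>c ws ! i) > 0"
        by (auto simp: less_eq_complex_def complex_eq_iff less_le)
      moreover define r where "r = Re (ws ! i \<bullet>c ws ! i)"
      ultimately have "ws ! i \<bullet>c ws ! i = complex_of_real r" "r > 0" by auto
      then show ?thesis using True ij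
        by (simp add: c_def flip: of_real_mult)
    qed
    finally show "(mat_adjoint U * U) $$ (i, j) = 1\<^sub>m n $$ (i, j)" .
  qed (use U in auto)
  moreover have "col U 0 = c 0 \<cdot>\<^sub>v v" using colU[of 0] n hdws by simp
  ultimately show thesis using that U unitary_matI by blast
qed

lemma four_block_mat_diag_mult:
  assumes "A1 \<in> carrier_mat k k" "D1 \<in> carrier_mat l l" "A2 \<in> carrier_mat k k" "D2 \<in> carrier_mat l l"
  shows "four_block_mat A1 (0\<^sub>m k l) (0\<^sub>m l k) D1 * four_block_mat A2 (0\<^sub>m k l) (0\<^sub>m l k) D2
    = four_block_mat (A1 * A2) (0\<^sub>m k l) (0\<^sub>m l k) (D1 * D2 :: 'a :: comm_ring_1 mat)"
  by (subst mult_four_block_mat[of _ k k _ l _ l _ _ k _ l]) (use assms in auto)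

text \<open>Deflation, by induction on the list of eigenvalues: split off a unit eigenvector for the
  first one and continue on its orthogonal complement. Any ordering \<open>es\<close> of the roots
  is allowed, so the order along the diagonal can be chosen later.\<close>

lemma hermitian_unitary_diagonalisation:
  assumes "A \<in> carrier_mat n n" "hermitian_mat A" "char_poly A = (\<Prod>e\<leftarrow>es. [:- e, 1:])"
  shows "\<exists>U \<in> carrier_mat n n. unitary_mat U \<and>
    mat_adjoint U * A * U = mat n n (\<lambda>(i, j). if i = j then es ! i else 0)"
  using assms
proof (induction es arbitrary: n A)
  case Nil
  then have "n = 0" using degree_monic_char_poly[of A n] by auto
  then show ?case using Nil by (intro bexI[of _ "1\<^sub>m 0"]) (auto intro!: unitary_matI[of _ 0] eq_matI)
next
  case (Cons e es)
  note A = Cons.prems(1)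
  have cp: "char_poly A = [:-e, 1:] * (\<Prod>e\<leftarrow>es. [:- e, 1:])" using Cons.prems by simp
  have ev: "eigenvalue A e"
    unfolding eigenvalue_root_char_poly[OF A] cp by simp
  then obtain v where v: "v \<in> carrier_vec n" "v \<noteq> 0\<^sub>v n" "A *\<^sub>v v = e \<cdot>\<^sub>v v"
    using A by (auto simp: eigenvalue_def eigenvector_def)
  then obtain m where n: "n = Suc m" by (cases n) auto
  obtain W c where W: "W \<in> carrier_mat n n" "unitary_mat W" "col W 0 = c \<cdot>\<^sub>v v"
    using unitary_mat_first_col[OF v(1,2)] .
  define B where "B = mat_adjoint W * A * W"
  have B: "B \<in> carrier_mat n n" "hermitian_mat B"
    unfolding B_def using A W Cons.prems by (auto intro!: hermitian_mat_conj)
  have AW: "col (A * W) 0 = e \<cdot>\<^sub>v col W 0"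
  proof -
    have "col (A * W) 0 = A *\<^sub>v (c \<cdot>\<^sub>v v)"
      unfolding W(3)[symmetric] using n by (intro col_mult2[OF A W(1)]) simp
    also have "\<dots> = c \<cdot>\<^sub>v (e \<cdot>\<^sub>v v)"
      using mult_mat_vec[OF A v(1)] v(3) by simp
    finally show ?thesis by (simp add: W(3) smult_smult_assoc mult.commute)
  qed
  \<comment> \<open>Column 0 of \<open>W\<close> is an eigenvector, so column 0 of \<open>B\<close>
    is \<open>e\<close> times column 0 of \<open>mat_adjoint W * W\<close>, the identity.\<close>
  have B0: "B $$ (i, 0) = (if i = 0 then e else 0)" if "i < n" for i
  proof -
    have "B $$ (i, 0) = row (mat_adjoint W) i \<bullet> col (A * W) 0"
      unfolding B_def using A W n that by (simp add: assoc_mult_mat[of _ n n _ n _ n])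
    also have "\<dots> = e * (mat_adjoint W * W) $$ (i, 0)"
      unfolding AW using W v(1) n that by (subst scalar_prod_smult_distrib[of _ n]) auto
    finally show ?thesis using that n by (simp add: unitary_matD[OF W(2,1)])
  qed
  \<comment> \<open>Hermitian symmetry turns the vanishing column into a vanishing row, so
    \<open>B\<close> splits into two diagonal blocks.\<close>
  have B0': "B $$ (0, i) = (if i = 0 then e else 0)" if "i < n" for i
    using B0[OF that] B0[of 0] hermitian_mat_index[OF B(2,1) that, of 0] that n
    by (auto split: if_splits)
  define D where "D = mat m m (\<lambda>(i, j). B $$ (Suc i, Suc j))"
  have D: "D \<in> carrier_mat m m" by (simp add: D_def)
  let ?E = "mat 1 1 (\<lambda>_. e)"
  have Bblock: "B = four_block_mat ?E (0\<^sub>m 1 m) (0\<^sub>m m 1) D"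
    using B n B0 B0' by (intro eq_matI) (auto simp: D_def)
  have hD: "hermitian_mat D"
  proof (rule hermitian_matI[OF D])
    fix i j assume "i < m" "j < m"
    then show "cnj (D $$ (i, j)) = D $$ (j, i)"
      using hermitian_mat_index[OF B(2,1), of "Suc i" "Suc j"] n by (simp add: D_def)
  qed
  \<comment> \<open>Similarity and the block form give a factorisation of
    \<open>char_poly A\<close>. Cancelling the factor of \<open>e\<close> leaves \<open>es\<close>
    as the list of roots for \<open>D\<close>, as the induction hypothesis requires.\<close>
  have "similar_mat A B" 
    using A B W unitary_matD[OF W(2,1)]
    by (intro similar_matI[of _ _ W "mat_adjoint W" n])
      (auto simp: B_def assoc_mult_mat[of _ n n _ n _ n] simp flip: assoc_mult_mat[of W n n "mat_adjoint W" n _ n])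
  then have "char_poly A = char_poly B" by (rule char_poly_similar)
  also have "\<dots> = char_poly ?E * char_poly D"
    unfolding Bblock by (rule char_poly_four_block_zeros_col) (use D in auto)
  also have "char_poly ?E = [:- e, 1:]"
    by (simp add: char_poly_defs det_def sign_def)
  finally have "char_poly D = (\<Prod>e\<leftarrow>es. [:- e, 1:])"
    using cp by (metis mult_cancel_left pCons_eq_0_iff zero_neq_one)
  from Cons.IH[OF D hD this] obtain V where V: "V \<in> carrier_mat m m" "unitary_mat V"
    "mat_adjoint V * D * V = mat m m (\<lambda>(i, j). if i = j then es ! i else 0)" by auto
  \<comment> \<open>\<open>V'\<close> fixes the eigenvector already found and acts as
    \<open>V\<close> on the complement.\<close>
  define V' where "V' = four_block_mat (1\<^sub>m 1) (0\<^sub>m 1 m) (0\<^sub>m m 1) V"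
  have V': "V' \<in> carrier_mat n n" using V n by (auto simp: V'_def)
  have adjV': "mat_adjoint V' = four_block_mat (1\<^sub>m 1) (0\<^sub>m 1 m) (0\<^sub>m m 1) (mat_adjoint V)"
  proof -
    have "mat_adjoint (1\<^sub>m 1 :: complex mat) = 1\<^sub>m 1" by (rule eq_matI) auto
    then show ?thesis unfolding V'_def using V by (subst mat_adjoint_four_block_diag) auto
  qed
  have "mat_adjoint V' * V' = 1\<^sub>m n"
    unfolding adjV' unfolding V'_def using V n
    by (subst four_block_mat_diag_mult) (auto simp: unitary_matD intro!: eq_matI)
  then have uV': "unitary_mat V'" by (rule unitary_matI[OF V'])
  have "mat_adjoint (W * V') * A * (W * V') = mat_adjoint V' * B * V'"
    unfolding B_def by (rule unitary_conj_mult[OF A W(1) V'])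
  also have "\<dots> = four_block_mat ?E (0\<^sub>m 1 m) (0\<^sub>m m 1) (mat_adjoint V * D * V)"
    unfolding adjV' unfolding Bblock V'_def using V(1) D
    by (subst four_block_mat_diag_mult four_block_mat_diag_mult[of _ _ "mat_adjoint V * D" m];
        auto intro!: mult_carrier_mat[of _ m m])+
  also have "\<dots> = mat n n (\<lambda>(i, j). if i = j then (e # es) ! i else 0)"
    unfolding V(3) using n by (intro eq_matI) (auto simp: nth_Cons')
  finally show ?case using W V' uV' by (intro bexI[of _ "W * V'"]) (auto intro!: unitary_mat_mult)
qed

section \<open>Ordered eigenbases and the vector of eigenvalues\<close>

text \<open>The conditions that \<open>co_diagonal\<close> puts on its witness, for one matrix at a
  time: co-diagonal matrices are those that commute and share such a \<open>U\<close>.\<close>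

definition eigenbasis_desc :: "nat \<Rightarrow> complex mat \<Rightarrow> complex mat \<Rightarrow> bool" where
  "eigenbasis_desc n U A \<longleftrightarrow> U \<in> carrier_mat n n \<and> unitary_mat U \<and> diagonal_desc_in U A"

lemma eigenbasis_desc_iff:
  assumes "A \<in> carrier_mat n n"
  shows "eigenbasis_desc n U A \<longleftrightarrow> U \<in> carrier_mat n n \<and> unitary_mat U \<and>
    (\<forall>i<n. \<forall>j<n. i \<noteq> j \<longrightarrow> (mat_adjoint U * A * U) $$ (i, j) = 0) \<and>
    (\<forall>i j. i \<le> j \<and> j < n \<longrightarrow>
      Re ((mat_adjoint U * A * U) $$ (j, j)) \<le> Re ((mat_adjoint U * A * U) $$ (i, i)))"
proof (cases "U \<in> carrier_mat n n")
  case True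
  then have "mat_adjoint U * A * U \<in> carrier_mat n n"
    using assms by (auto intro!: mult_carrier_mat[of _ n n])
  moreover define D where "D = mat_adjoint U * A * U"
  ultimately have "dim_row D = n" "dim_col D = n" by auto
  then show ?thesis
    unfolding eigenbasis_desc_def diagonal_desc_in_def Let_def diagonal_mat_def D_def[symmetric]
    by simp
qed (auto simp: eigenbasis_desc_def)

lemma proots_linear_factors:
  "proots (\<Prod>a\<leftarrow>as. [:- a, 1:] :: 'a :: idom poly) = mset as"
proof (induction as)
  case (Cons a as)
  have "(\<Prod>a\<leftarrow>as. [:- a, 1:]) \<noteq> 0" by (auto simp: prod_list_zero_iff)
  then have "proots ([:- a, 1:] * (\<Prod>a\<leftarrow>as. [:- a, 1:])) = add_mset a (mset as)"
    unfolding Cons.IH[symmetric] by (subst proots_mult) auto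
  then show ?case by simp
qed simp

text \<open>Similar matrices have the same characteristic polynomial, and that of a diagonal matrix
  has the diagonal entries as its roots. These already stand in non-increasing order, so sorting
  does not move them. Since \<open>U\<close> is arbitrary, a basis shared by several matrices can be
  used.\<close>

lemma eigvals_desc_eq:
  assumes A: "A \<in> carrier_mat n n" and U: "eigenbasis_desc n U A"
  shows "eigvals_desc A = vec n (\<lambda>i. Re ((mat_adjoint U * A * U) $$ (i, i)))"
proof -
  define D where "D = mat_adjoint U * A * U"
  have Uc: "U \<in> carrier_mat n n" "unitary_mat U" using U by (auto simp: eigenbasis_desc_def)
  have D: "D \<in> carrier_mat n n"
    unfolding D_def using Uc A by (auto intro!: mult_carrier_mat[of _ n n])
  have diag: "D $$ (i, j) = 0" if "i < n" "j < n" "i \<noteq> j" for i j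
    using U that unfolding eigenbasis_desc_iff[OF A] D_def by auto
  have desc: "Re (D $$ (j, j)) \<le> Re (D $$ (i, i))" if "i \<le> j" "j < n" for i j
    using U that unfolding eigenbasis_desc_iff[OF A] D_def by auto
  have c: "mat_adjoint U \<in> carrier_mat n n" "A * U \<in> carrier_mat n n" using A Uc by auto
  have "U * (mat_adjoint U * (A * U)) * mat_adjoint U = A"
  proof -
    have "U * (mat_adjoint U * (A * U)) = (U * mat_adjoint U) * (A * U)"
      using c Uc by (simp add: assoc_mult_mat[of _ n n _ n _ n])
    also have "\<dots> = A * U" using c Uc by (simp add: unitary_matD left_mult_one_mat[of _ n n])
    finally have "U * (mat_adjoint U * (A * U)) * mat_adjoint U = A * (U * mat_adjoint U)"
      using A c Uc by (simp add: assoc_mult_mat[of _ n n _ n _ n])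
    then show ?thesis using A Uc by (simp add: unitary_matD)
  qed
  moreover have "D = mat_adjoint U * (A * U)"
    unfolding D_def using A c Uc by (simp add: assoc_mult_mat[of _ n n _ n _ n])
  ultimately have "similar_mat A D"
    using A D Uc c by (intro similar_matI[of _ _ U "mat_adjoint U" n]) (auto simp: unitary_matD)
  then have "char_poly A = char_poly D" by (rule char_poly_similar)
  also have "\<dots> = (\<Prod>a\<leftarrow>diag_mat D. [:- a, 1:])"
    by (rule char_poly_upper_triangular[OF D]) (use D diag in auto)
  finally have "image_mset Re (proots (char_poly A)) = mset (map Re (diag_mat D))"
    by (simp add: proots_linear_factors)
  moreover have "sort (map Re (diag_mat D)) = rev (map Re (diag_mat D))"
  proof (rule properties_for_sort)
    show "sorted (rev (map Re (diag_mat D)))"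
      using D by (auto simp: diag_mat_def sorted_iff_nth_mono rev_nth intro!: desc)
  qed simp
  ultimately have "eigvals_desc A = vec_of_list (map Re (diag_mat D))"
    unfolding eigvals_desc_def by (metis sorted_list_of_multiset_mset rev_rev_ident)
  also have "\<dots> = vec n (\<lambda>i. Re (D $$ (i, i)))"
    using D by (intro eq_vecI) (auto simp: diag_mat_def vec_of_list_index)
  finally show ?thesis by (simp add: D_def)
qed

text \<open>The eigenvalues are real, hence can be sorted, and the diagonalisation accepts them in
  the sorted order.\<close>

lemma eigenbasis_desc_exists:
  assumes A: "A \<in> carrier_mat n n" and h: "hermitian_mat A"
  obtains U where "eigenbasis_desc n U A"
proof -
  obtain as where as: "char_poly A = (\<Prod>a\<leftarrow>as. [:- a, 1:])" "length as = n"
    using char_poly_factorized[OF A] by auto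
  \<comment> \<open>This first diagonalisation serves only to show that the roots are real: they are
    diagonal entries of a Hermitian matrix.\<close>
  obtain U where U: "U \<in> carrier_mat n n"
    "mat_adjoint U * A * U = mat n n (\<lambda>(i, j). if i = j then as ! i else 0)"
    using hermitian_unitary_diagonalisation[OF A h as(1)] by auto
  have real: "complex_of_real (Re a) = a" if "a \<in> set as" for a
  proof -
    obtain i where i: "i < n" "a = as ! i" using \<open>a \<in> set as\<close> as(2) by (auto simp: in_set_conv_nth)
    have "cnj ((mat_adjoint U * A * U) $$ (i, i)) = (mat_adjoint U * A * U) $$ (i, i)"
      by (rule hermitian_mat_index[OF hermitian_mat_conj[OF A U(1) h], of n])
        (use U i in auto)
    then have "cnj a = a" using i by (simp add: U(2))
    then show ?thesis by (simp add: complex_eq_iff)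
  qed
  define rs where "rs = rev (sort (map Re as))"
  define es where "es = map complex_of_real rs"
  have len: "length es = n" "length rs = n" using as by (simp_all add: es_def rs_def)
  \<comment> \<open>\<open>es\<close> is a permutation of \<open>as\<close>, so the product of
    linear factors is the same polynomial.\<close>
  have "mset es = image_mset (\<lambda>a. complex_of_real (Re a)) (mset as)"
    by (simp add: es_def rs_def image_mset.compositionality o_def)
  also have "\<dots> = image_mset (\<lambda>a. a) (mset as)"
    by (rule image_mset_cong) (simp add: real)
  also have "\<dots> = mset as" by simp
  finally have "mset (map (\<lambda>a. [:- a, 1:]) es) = mset (map (\<lambda>a. [:- a, 1:]) as)" by simp
  then have "char_poly A = (\<Prod>a\<leftarrow>es. [:- a, 1:])"
    unfolding as(1) by (metis prod_mset_prod_list)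
  from hermitian_unitary_diagonalisation[OF A h this] obtain V where
    V: "V \<in> carrier_mat n n" "unitary_mat V"
    "mat_adjoint V * A * V = mat n n (\<lambda>(i, j). if i = j then es ! i else 0)" by auto
  have "rs ! j \<le> rs ! i" if "i \<le> j" "j < n" for i j
  proof -
    have "sorted (rev rs)" by (simp add: rs_def)
    then show ?thesis using that len by (simp add: sorted_rev_iff_nth_mono)
  qed
  then have "eigenbasis_desc n V A"
    unfolding eigenbasis_desc_iff[OF A] using V len by (auto simp: es_def)
  then show thesis using that by blast
qed

lemma dim_eigvals_desc:
  assumes "A \<in> carrier_mat n n" "hermitian_mat A"
  shows "dim_vec (eigvals_desc A) = n"
  using eigenbasis_desc_exists[OF assms] eigvals_desc_eq[OF assms(1)] by (metis dim_vec)

lemma eigvals_desc_mono: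
  assumes "A \<in> carrier_mat n n" "hermitian_mat A" "i \<le> j" "j < n"
  shows "eigvals_desc A $ j \<le> eigvals_desc A $ i"
proof -
  obtain U where U: "eigenbasis_desc n U A" using eigenbasis_desc_exists assms by blast
  then show ?thesis
    using assms by (simp add: eigvals_desc_eq[OF assms(1) U] eigenbasis_desc_iff[OF assms(1)])
qed

section \<open>Ky Fan's maximum principle\<close>

definition top_eigval_sum :: "nat \<Rightarrow> complex mat \<Rightarrow> real" where
  "top_eigval_sum k A = (\<Sum>j<k. eigvals_desc A $ j)"

text \<open>Weights in [0, 1] with total mass \<open>k\<close> do best when they sit on the
  \<open>k\<close> largest values. Subtracting the threshold \<open>c\<close> from all values
  changes both sides by \<open>c * k\<close> and makes a comparison term by term possible.\<close>

lemma sum_mult_le_sum_largest: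
  fixes d p :: "nat \<Rightarrow> real"
  assumes "\<And>i j. i \<le> j \<Longrightarrow> j < n \<Longrightarrow> d j \<le> d i"
    and "\<And>i. i < n \<Longrightarrow> 0 \<le> p i" "\<And>i. i < n \<Longrightarrow> p i \<le> 1"
    and "(\<Sum>i<n. p i) = real k" "k \<le> n"
  shows "(\<Sum>i<n. d i * p i) \<le> (\<Sum>i<k. d i)"
proof -
  \<comment> \<open>For \<open>k = 0\<close> truncated subtraction gives \<open>c = d 0\<close>; no
    index is then below \<open>k\<close>, and \<open>c\<close> still bounds the remaining values
    from above.\<close>
  define c where "c = d (k - 1)"
  have "(\<Sum>i<n. (d i - c) * p i) \<le> (\<Sum>i<n. if i < k then d i - c else 0)"
  proof (rule sum_mono)
    fix i assume "i \<in> {..<n}"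
    then have i: "i < n" by simp
    show "(d i - c) * p i \<le> (if i < k then d i - c else 0)"
    proof (cases "i < k")
      case True
      then have "d i - c \<ge> 0" using assms(1)[of i "k - 1"] \<open>k \<le> n\<close> by (simp add: c_def)
      then show ?thesis using True assms(3)[OF i] mult_left_mono[of "p i" 1 "d i - c"] by simp
    next
      case False
      then have "d i - c \<le> 0" using assms(1)[of "k - 1" i] i by (simp add: c_def)
      then show ?thesis using False assms(2)[OF i] by (simp add: mult_nonpos_nonneg)
    qed
  qed
  also have "\<dots> = (\<Sum>i<k. d i - c)"
    using \<open>k \<le> n\<close> by (intro sum.mono_neutral_cong_right) auto
  finally show ?thesis
    using assms(4) by (simp add: left_diff_distrib sum_subtractf flip: sum_distrib_left)
qed

text \<open>Together with its row version this says that the squared moduli of the entries form a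
  doubly stochastic matrix.\<close>

lemma unitary_mat_sum_norm_col:
  assumes "unitary_mat W" "W \<in> carrier_mat n n" "j < n"
  shows "(\<Sum>i<n. (cmod (W $$ (i, j)))\<^sup>2) = 1"
proof -
  have "complex_of_real (\<Sum>i<n. (cmod (W $$ (i, j)))\<^sup>2) = (mat_adjoint W * W) $$ (j, j)"
    using assms by (auto simp: scalar_prod_def complex_norm_square mult.commute lessThan_atLeast0 simp del: of_real_power intro!: sum.cong)
  also have "\<dots> = 1" using assms by (simp add: unitary_matD)
  finally show ?thesis by (simp only: of_real_eq_1_iff)
qed

lemma unitary_mat_sum_norm_row:
  assumes "unitary_mat W" "W \<in> carrier_mat n n" "i < n"
  shows "(\<Sum>j<n. (cmod (W $$ (i, j)))\<^sup>2) = 1"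
  using unitary_mat_sum_norm_col[OF unitary_mat_adjoint[OF assms(1,2)] _ assms(3)] assms by simp

text \<open>With respect to an eigenbasis of \<open>X\<close>, each diagonal entry of the conjugated
  matrix is an average of the eigenvalues, weighted by squared moduli of entries of a unitary
  \<open>W\<close>. Over \<open>k\<close> columns the total weights are at most 1 each and sum to
  \<open>k\<close>.\<close>

lemma ky_fan:
  assumes X: "X \<in> carrier_mat n n" "hermitian_mat X"
    and V: "V \<in> carrier_mat n n" "unitary_mat V" and k: "k \<le> n"
  shows "(\<Sum>j<k. Re ((mat_adjoint V * X * V) $$ (j, j))) \<le> top_eigval_sum k X"
proof -
  obtain U where U: "eigenbasis_desc n U X" using eigenbasis_desc_exists X by blast
  then have Uc: "U \<in> carrier_mat n n" "unitary_mat U" by (auto simp: eigenbasis_desc_def)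
  define D where "D = mat_adjoint U * X * U"
  \<comment> \<open>\<open>W\<close> expresses the columns of \<open>V\<close> in the eigenbasis
    \<open>U\<close>.\<close>
  define W where "W = mat_adjoint U * V"
  define d where "d i = eigvals_desc X $ i" for i
  have D: "D \<in> carrier_mat n n"
    unfolding D_def using Uc X by (auto intro!: mult_carrier_mat[of _ n n])
  have Dij: "D $$ (i, j) = (if i = j then complex_of_real (d i) else 0)" if "i < n" "j < n" for i j
  proof (cases "i = j")
    case True
    have "cnj (D $$ (i, i)) = D $$ (i, i)"
      by (rule hermitian_mat_index[of _ n]) (use D X Uc that in \<open>auto simp: D_def intro: hermitian_mat_conj\<close>)
    moreover have "d i = Re (D $$ (i, i))"
      unfolding d_def D_def eigvals_desc_eq[OF X(1) U] using that by simp
    ultimately show ?thesis using True by (simp add: complex_eq_iff)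
  next
    case False
    then show ?thesis using U that unfolding eigenbasis_desc_iff[OF X(1)] D_def by simp
  qed
  have W: "W \<in> carrier_mat n n" "unitary_mat W"
    using Uc V by (auto simp: W_def intro!: unitary_mat_mult unitary_mat_adjoint)
  have VUW: "V = U * W"
  proof -
    have "U * W = (U * mat_adjoint U) * V"
      unfolding W_def using Uc V by (simp add: assoc_mult_mat[of _ n n _ n _ n])
    then show ?thesis using Uc V by (simp add: unitary_matD)
  qed
  have VXV: "mat_adjoint V * X * V = mat_adjoint W * D * W"
    unfolding VUW D_def by (rule unitary_conj_mult[OF X(1) Uc(1) W(1)])
  have diag: "Re ((mat_adjoint V * X * V) $$ (j, j)) = (\<Sum>i<n. d i * (cmod (W $$ (i, j)))\<^sup>2)"
    if "j < n" for j
  proof -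
    have WD: "(mat_adjoint W * D) $$ (j, i) = cnj (W $$ (i, j)) * d i" if "i < n" for i
    proof -
      have "(mat_adjoint W * D) $$ (j, i) = (\<Sum>l = 0..<n. cnj (W $$ (l, j)) * D $$ (l, i))"
        using W D that \<open>j < n\<close> by (simp add: scalar_prod_def)
      also have "\<dots> = (\<Sum>l = 0..<n. if l = i then cnj (W $$ (l, j)) * d l else 0)"
        using that by (intro sum.cong) (auto simp: Dij)
      finally show ?thesis using that by simp
    qed
    have "(mat_adjoint W * D * W) $$ (j, j) = (\<Sum>i = 0..<n. (mat_adjoint W * D) $$ (j, i) * W $$ (i, j))"
      using W D \<open>j < n\<close> by (simp add: scalar_prod_def)
    also have "\<dots> = (\<Sum>i<n. complex_of_real (d i * (cmod (W $$ (i, j)))\<^sup>2))"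
      by (rule sum.cong)
        (auto simp: WD complex_norm_square mult_ac simp del: of_real_power)
    finally show ?thesis by (simp add: VXV flip: of_real_sum)
  qed
  have "(\<Sum>j<k. Re ((mat_adjoint V * X * V) $$ (j, j)))
      = (\<Sum>j<k. \<Sum>i<n. d i * (cmod (W $$ (i, j)))\<^sup>2)"
    using k by (intro sum.cong) (auto simp: diag)
  \<comment> \<open>Exchanging the sums collects the total weight of each eigenvalue: a partial row
    sum, at most 1 because full rows sum to 1. The column sums give total mass
    \<open>k\<close>.\<close>
  also have "\<dots> = (\<Sum>i<n. d i * (\<Sum>j<k. (cmod (W $$ (i, j)))\<^sup>2))"
    by (subst sum.swap) (simp add: sum_distrib_left)
  also have "\<dots> \<le> (\<Sum>i<k. d i)"
  proof (rule sum_mult_le_sum_largest)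
    show "d j \<le> d i" if "i \<le> j" "j < n" for i j
      unfolding d_def using eigvals_desc_mono[OF X that] .
    show "(\<Sum>j<k. (cmod (W $$ (i, j)))\<^sup>2) \<le> 1" if "i < n" for i
    proof -
      have "(\<Sum>j<k. (cmod (W $$ (i, j)))\<^sup>2) \<le> (\<Sum>j<n. (cmod (W $$ (i, j)))\<^sup>2)"
        using k by (intro sum_mono2) auto
      then show ?thesis using unitary_mat_sum_norm_row[OF W(2,1) that] by simp
    qed
    have "(\<Sum>i<n. \<Sum>j<k. (cmod (W $$ (i, j)))\<^sup>2) = (\<Sum>j<k. \<Sum>i<n. (cmod (W $$ (i, j)))\<^sup>2)"
      by (rule sum.swap)
    also have "\<dots> = (\<Sum>j<k. 1)"
      using k by (intro sum.cong refl unitary_mat_sum_norm_col[OF W(2,1)]) auto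
    finally show "(\<Sum>i<n. \<Sum>j<k. (cmod (W $$ (i, j)))\<^sup>2) = real k" by simp
  qed (use k in \<open>auto intro: sum_nonneg\<close>)
  finally show ?thesis by (simp add: top_eigval_sum_def d_def)
qed

section \<open>Sublinearity of the sum of the largest eigenvalues\<close>

lemma index_conj_add_smult:
  fixes A B U :: "complex mat"
  assumes "A \<in> carrier_mat n n" "B \<in> carrier_mat n n" "U \<in> carrier_mat n n" "i < n" "j < n"
  shows "(mat_adjoint U * (s \<cdot>\<^sub>m A + t \<cdot>\<^sub>m B) * U) $$ (i, j) =
    s * (mat_adjoint U * A * U) $$ (i, j) + t * (mat_adjoint U * B * U) $$ (i, j)"
proof -
  have c: "mat_adjoint U \<in> carrier_mat n n" "mat_adjoint U * A \<in> carrier_mat n n"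
    "mat_adjoint U * B \<in> carrier_mat n n" using assms by auto
  have "mat_adjoint U * (s \<cdot>\<^sub>m A + t \<cdot>\<^sub>m B) * U =
      s \<cdot>\<^sub>m (mat_adjoint U * A * U) + t \<cdot>\<^sub>m (mat_adjoint U * B * U)"
    using assms c
    by (simp add: mult_add_distrib_mat[of _ n n _ n] add_mult_distrib_mat[of _ n n _ _ n]
        mult_smult_distrib[of _ n n _ n] mult_smult_assoc_mat[of _ n n _ n])
  moreover have "(s \<cdot>\<^sub>m P + t \<cdot>\<^sub>m Q) $$ (i, j) = s * P $$ (i, j) + t * Q $$ (i, j)"
    if "P \<in> carrier_mat n n" "Q \<in> carrier_mat n n" for P Q
    using that assms(4,5) by simp
  ultimately show ?thesis using assms(3) c by (simp only: mult_carrier_mat)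
qed

text \<open>An ordered eigenbasis \<open>V\<close> of \<open>X + Y\<close> attains the sum for
  \<open>X + Y\<close>, while for \<open>X\<close> and \<open>Y\<close> separately it is merely one
  candidate in Ky Fan's bound.\<close>

lemma top_eigval_sum_subadditive:
  assumes X: "X \<in> carrier_mat n n" "hermitian_mat X" and Y: "Y \<in> carrier_mat n n" "hermitian_mat Y"
    and k: "k \<le> n"
  shows "top_eigval_sum k (X + Y) \<le> top_eigval_sum k X + top_eigval_sum k Y"
proof -
  have XY: "X + Y \<in> carrier_mat n n" using X Y by simp
  obtain V where V: "eigenbasis_desc n V (X + Y)"
    using eigenbasis_desc_exists[OF XY] hermitian_mat_add X Y by blast
  then have Vc: "V \<in> carrier_mat n n" "unitary_mat V" by (auto simp: eigenbasis_desc_def)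
  have "top_eigval_sum k (X + Y) = (\<Sum>j<k. Re ((mat_adjoint V * (X + Y) * V) $$ (j, j)))"
    unfolding top_eigval_sum_def eigvals_desc_eq[OF XY V] using k by (intro sum.cong) auto
  also have "\<dots> = (\<Sum>j<k. Re ((mat_adjoint V * X * V) $$ (j, j))) +
      (\<Sum>j<k. Re ((mat_adjoint V * Y * V) $$ (j, j)))"
  proof -
    have "1 \<cdot>\<^sub>m X + 1 \<cdot>\<^sub>m Y = X + Y" using X Y by (intro eq_matI) auto
    then show ?thesis
      unfolding sum.distrib[symmetric]
      using index_conj_add_smult[OF X(1) Y(1) Vc(1), of _ _ 1 1] k
      by (intro sum.cong refl) (simp del: index_mult_mat(1) assoc_mult_mat)
  qed
  also have "\<dots> \<le> top_eigval_sum k X + top_eigval_sum k Y"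
    using ky_fan[OF X Vc k] ky_fan[OF Y Vc k] by simp
  finally show ?thesis .
qed

text \<open>Nonnegative coefficients preserve the non-increasing order of both diagonals, so
  \<open>U\<close> is an ordered eigenbasis of the combination too and the eigenvalues combine entry
  by entry.\<close>

lemma top_eigval_sum_common_eigenbasis:
  assumes A: "A \<in> carrier_mat n n" and B: "B \<in> carrier_mat n n"
    and U: "eigenbasis_desc n U A" "eigenbasis_desc n U B"
    and st: "0 \<le> s" "0 \<le> t" and k: "k \<le> n"
  shows "top_eigval_sum k (complex_of_real s \<cdot>\<^sub>m A + complex_of_real t \<cdot>\<^sub>m B) =
    s * top_eigval_sum k A + t * top_eigval_sum k B"
proof -
  let ?M = "complex_of_real s \<cdot>\<^sub>m A + complex_of_real t \<cdot>\<^sub>m B"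
  have M: "?M \<in> carrier_mat n n" using A B by simp
  have Uc: "U \<in> carrier_mat n n" "unitary_mat U" using U by (auto simp: eigenbasis_desc_def)
  note ix = index_conj_add_smult[OF A B Uc(1)]
  have UM: "eigenbasis_desc n U ?M"
    using U st unfolding eigenbasis_desc_iff[OF M] eigenbasis_desc_iff[OF A] eigenbasis_desc_iff[OF B]
    by (auto simp: ix intro!: add_mono mult_left_mono)
  show ?thesis
    unfolding top_eigval_sum_def eigvals_desc_eq[OF M UM] eigvals_desc_eq[OF A U(1)]
      eigvals_desc_eq[OF B U(2)] sum_distrib_left sum.distrib[symmetric]
    using k by (intro sum.cong) (auto simp: ix)
qed

lemma top_eigval_sum_smult:
  assumes A: "A \<in> carrier_mat n n" "hermitian_mat A" and "0 \<le> s" "k \<le> n"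
  shows "top_eigval_sum k (complex_of_real s \<cdot>\<^sub>m A) = s * top_eigval_sum k A"
proof -
  obtain U where U: "eigenbasis_desc n U A" using eigenbasis_desc_exists A by blast
  have "complex_of_real s \<cdot>\<^sub>m A + complex_of_real 0 \<cdot>\<^sub>m A = complex_of_real s \<cdot>\<^sub>m A"
    using A by (intro eq_matI) auto
  then show ?thesis
    using top_eigval_sum_common_eigenbasis[OF A(1) A(1) U U, of s 0 k] assms by simp
qed

lemma top_eigval_sum_0 [simp]: "top_eigval_sum 0 A = 0"
  by (simp add: top_eigval_sum_def)

section \<open>Difference quotients and their limit from the right\<close>

text \<open>All values lie above the infimum, and monotonicity carries a value below
  \<open>y\<close> at one point \<open>t\<close> to every point between \<open>a\<close> and
  \<open>t\<close>.\<close>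

lemma mono_tendsto_Inf_at_right:
  fixes f :: "real \<Rightarrow> real"
  assumes "\<And>s t. a < s \<Longrightarrow> s \<le> t \<Longrightarrow> f s \<le> f t" "bdd_below (f ` {a<..})"
  shows "(f \<longlongrightarrow> Inf (f ` {a<..})) (at_right a)"
proof (rule order_tendstoI)
  fix y assume "y < Inf (f ` {a<..})"
  then have "y < f t" if "a < t" for t
    using cInf_lower[OF _ assms(2), of "f t"] that by fastforce
  then show "\<forall>\<^sub>F t in at_right a. y < f t"
    by (auto simp: eventually_at_right_less intro: eventually_mono[OF eventually_at_right_less])
next
  fix y assume "Inf (f ` {a<..}) < y"
  then obtain t where t: "a < t" "f t < y"
    using cInf_lessD[of "f ` {a<..}" y] by auto
  then have "f s < y" if "a < s" "s < t" for s
    using assms(1)[of s t] that by simp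
  then show "\<forall>\<^sub>F s in at_right a. f s < y"
    using t(1) unfolding eventually_at_right_field by blast
qed

definition top_eigval_quotient :: "nat \<Rightarrow> complex mat \<Rightarrow> complex mat \<Rightarrow> real \<Rightarrow> real" where
  "top_eigval_quotient k X A t =
    (top_eigval_sum k (A + complex_of_real t \<cdot>\<^sub>m X) - top_eigval_sum k A) / t"

context
  fixes n k :: nat and A X :: "complex mat"
  assumes A: "A \<in> carrier_mat n n" "hermitian_mat A"
    and X: "X \<in> carrier_mat n n" "hermitian_mat X"
    and k: "k \<le> n"
begin

text \<open>Slopes of a convex function from a fixed base point increase: \<open>A + s X\<close> is
  the convex combination of \<open>A\<close> and \<open>A + t X\<close> with weight
  \<open>r = s / t\<close> on the latter.\<close>

lemma top_eigval_quotient_mono: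
  assumes "0 < s" "s \<le> t"
  shows "top_eigval_quotient k X A s \<le> top_eigval_quotient k X A t"
proof -
  define r where "r = s / t"
  have r: "0 \<le> r" "r \<le> 1" "s = r * t" using assms by (auto simp: r_def)
  define B where "B = A + complex_of_real t \<cdot>\<^sub>m X"
  have B: "B \<in> carrier_mat n n" "hermitian_mat B"
    unfolding B_def using A X by (auto intro!: hermitian_mat_add hermitian_mat_smult)
  have "A + complex_of_real s \<cdot>\<^sub>m X = complex_of_real (1 - r) \<cdot>\<^sub>m A + complex_of_real r \<cdot>\<^sub>m B"
    unfolding B_def r(3) using A X by (intro eq_matI) (auto simp: algebra_simps)
  then have "top_eigval_sum k (A + complex_of_real s \<cdot>\<^sub>m X)
      \<le> top_eigval_sum k (complex_of_real (1 - r) \<cdot>\<^sub>m A) + top_eigval_sum k (complex_of_real r \<cdot>\<^sub>m B)"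
    using A B k by (simp only:)
      (intro top_eigval_sum_subadditive[of _ n]; simp add: hermitian_mat_smult del: of_real_diff)
  also have "\<dots> = (1 - r) * top_eigval_sum k A + r * top_eigval_sum k B"
    using r A B k by (simp add: top_eigval_sum_smult[of _ n] del: of_real_diff)
  finally have "top_eigval_sum k (A + complex_of_real s \<cdot>\<^sub>m X) - top_eigval_sum k A
      \<le> r * (top_eigval_sum k B - top_eigval_sum k A)"
    by (simp add: algebra_simps)
  then have "top_eigval_quotient k X A s \<le> r * (top_eigval_sum k B - top_eigval_sum k A) / s"
    unfolding top_eigval_quotient_def using assms by (simp add: divide_right_mono)
  also have "\<dots> = top_eigval_quotient k X A t"
    using assms by (simp add: top_eigval_quotient_def B_def r_def)
  finally show ?thesis .
qed

lemma top_eigval_quotient_le: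
  assumes "0 < t"
  shows "top_eigval_quotient k X A t \<le> top_eigval_sum k X"
proof -
  have "top_eigval_sum k (A + complex_of_real t \<cdot>\<^sub>m X)
      \<le> top_eigval_sum k A + top_eigval_sum k (complex_of_real t \<cdot>\<^sub>m X)"
    using A X k by (intro top_eigval_sum_subadditive[of _ n]) (auto simp: hermitian_mat_smult)
  also have "top_eigval_sum k (complex_of_real t \<cdot>\<^sub>m X) = t * top_eigval_sum k X"
    using X k assms by (intro top_eigval_sum_smult[of _ n]) auto
  finally show ?thesis using assms by (simp add: top_eigval_quotient_def field_simps)
qed

text \<open>Subadditivity applied to \<open>A = (A + t X) + t (- X)\<close>. The bound does not
  depend on \<open>t\<close>, so the infimum of the quotients is finite.\<close>

lemma top_eigval_quotient_ge:
  assumes "0 < t"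
  shows "- top_eigval_sum k (complex_of_real (-1) \<cdot>\<^sub>m X) \<le> top_eigval_quotient k X A t"
proof -
  define Y where "Y = complex_of_real (-1) \<cdot>\<^sub>m X"
  have Y: "Y \<in> carrier_mat n n" "hermitian_mat Y"
    unfolding Y_def using X by (auto simp del: of_real_minus intro!: hermitian_mat_smult)
  have "(A + complex_of_real t \<cdot>\<^sub>m X) + complex_of_real t \<cdot>\<^sub>m Y = A"
    unfolding Y_def using A X by (intro eq_matI) auto
  then have "top_eigval_sum k A
      \<le> top_eigval_sum k (A + complex_of_real t \<cdot>\<^sub>m X) + top_eigval_sum k (complex_of_real t \<cdot>\<^sub>m Y)"
    using top_eigval_sum_subadditive[of "A + complex_of_real t \<cdot>\<^sub>m X" n "complex_of_real t \<cdot>\<^sub>m Y" k] A X Y k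
    by (simp add: hermitian_mat_smult hermitian_mat_add[of _ n])
  also have "top_eigval_sum k (complex_of_real t \<cdot>\<^sub>m Y) = t * top_eigval_sum k Y"
    using Y k assms by (intro top_eigval_sum_smult[of _ n]) auto
  finally show ?thesis
    unfolding Y_def[symmetric] using assms by (simp add: top_eigval_quotient_def field_simps)
qed

lemma bdd_below_top_eigval_quotient: "bdd_below (top_eigval_quotient k X A ` {0<..})"
  using top_eigval_quotient_ge by (auto simp: bdd_below_def)

lemma top_eigval_quotient_tendsto:
  "(top_eigval_quotient k X A \<longlongrightarrow> Inf (top_eigval_quotient k X A ` {0<..})) (at_right 0)"
  using top_eigval_quotient_mono bdd_below_top_eigval_quotient
  by (rule mono_tendsto_Inf_at_right)

end

section \<open>Existence, uniqueness and properties of \<open>delta\<close>\<close>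

lemma is_delta_iff:
  assumes A: "A \<in> carrier_mat n n"
  shows "is_delta X A d \<longleftrightarrow> d \<in> carrier_vec n \<and>
    (\<forall>k\<in>{1..n}. (top_eigval_quotient k X A \<longlongrightarrow> (\<Sum>j<k. d $ j)) (at_right 0))"
proof -
  have "(\<lambda>t. 1 / t * (\<Sum>j<k. eigvals_desc (A + complex_of_real t \<cdot>\<^sub>m X) $ j - eigvals_desc A $ j))
      = top_eigval_quotient k X A" for k
    by (simp add: top_eigval_quotient_def top_eigval_sum_def sum_subtractf fun_eq_iff)
  then show ?thesis using A by (simp add: is_delta_def)
qed

text \<open>Limits are unique, so all prefix sums agree, and an entry is the difference of two
  consecutive ones. The prefix of length 0, on which \<open>is_delta\<close> is silent, is an empty
  sum.\<close>

lemma is_delta_unique: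
  assumes A: "A \<in> carrier_mat n n" and "is_delta X A d" "is_delta X A d'"
  shows "d = d'"
proof (rule eq_vecI)
  have d: "d \<in> carrier_vec n" "d' \<in> carrier_vec n"
    using assms by (auto simp: is_delta_iff)
  then show "dim_vec d = dim_vec d'" by simp
  have prefix: "(\<Sum>j<k. d $ j) = (\<Sum>j<k. d' $ j)" if "k \<le> n" for k
  proof (cases "k = 0")
    case False
    then have "k \<in> {1..n}" using that by simp
    then show ?thesis
      using assms(2,3) unfolding is_delta_iff[OF A]
      by (meson tendsto_unique trivial_limit_at_right_real)
  qed simp
  fix i assume "i < dim_vec d'"
  then show "d $ i = d' $ i" using prefix[of i] prefix[of "Suc i"] d by simp
qed

text \<open>Justifies the definite description in \<open>delta\<close>: the vector of increments of
  the limits \<open>L\<close> satisfies \<open>is_delta\<close>, and it is the only one.\<close>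

lemma delta_tendsto:
  assumes A: "A \<in> carrier_mat n n" "hermitian_mat A" and X: "X \<in> carrier_mat n n" "hermitian_mat X"
  shows "delta X A \<in> carrier_vec n"
    and "k \<in> {1..n} \<Longrightarrow>
      (top_eigval_quotient k X A \<longlongrightarrow> (\<Sum>j<k. delta X A $ j)) (at_right 0)"
proof -
  define L where "L k = Inf (top_eigval_quotient k X A ` {0<..})" for k
  define d where "d = vec n (\<lambda>j. L (Suc j) - L j)"
  \<comment> \<open>The telescoping sum below yields \<open>L k - L 0\<close>, so the value at 0 has
    to vanish.\<close>
  have L0: "L 0 = 0"
    by (simp add: L_def top_eigval_quotient_def image_constant_conv)
  have "(\<Sum>j<k. d $ j) = L k" if "k \<le> n" for k
  proof -
    have "(\<Sum>j<k. d $ j) = (\<Sum>j<k. L (Suc j) - L j)"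
      using that by (intro sum.cong) (auto simp: d_def)
    then show ?thesis by (simp add: sum_lessThan_telescope L0)
  qed
  then have "is_delta X A d"
    unfolding is_delta_iff[OF A(1)] L_def
    using top_eigval_quotient_tendsto[OF A X] by (auto simp: d_def)
  then have "is_delta X A (delta X A)"
    unfolding delta_def by (rule theI) (use is_delta_unique[OF A(1)] \<open>is_delta X A d\<close> in blast)
  then show "delta X A \<in> carrier_vec n"
    "k \<in> {1..n} \<Longrightarrow> (top_eigval_quotient k X A \<longlongrightarrow> (\<Sum>j<k. delta X A $ j)) (at_right 0)"
    unfolding is_delta_iff[OF A(1)] by auto
qed

lemma sum_delta_eqI:
  assumes "A \<in> carrier_mat n n" "hermitian_mat A" "X \<in> carrier_mat n n" "hermitian_mat X"
    and "k \<in> {1..n}" "(top_eigval_quotient k X A \<longlongrightarrow> L) (at_right 0)"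
  shows "(\<Sum>j<k. delta X A $ j) = L"
  using delta_tendsto(2)[OF assms(1-5)] assms(6)
  by (meson tendsto_unique trivial_limit_at_right_real)

text \<open>The limit of the monotone quotients is their infimum, hence a lower bound for each of
  them.\<close>

lemma sum_delta_le_quotient:
  assumes A: "A \<in> carrier_mat n n" "hermitian_mat A" and X: "X \<in> carrier_mat n n" "hermitian_mat X"
    and k: "k \<in> {1..n}" and "0 < t"
  shows "(\<Sum>j<k. delta X A $ j) \<le> top_eigval_quotient k X A t"
proof -
  have kn: "k \<le> n" using k by simp
  have "(\<Sum>j<k. delta X A $ j) = Inf (top_eigval_quotient k X A ` {0<..})"
    by (rule sum_delta_eqI[OF A X k top_eigval_quotient_tendsto[OF A X kn]])
  also have "\<dots> \<le> top_eigval_quotient k X A t"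
    using bdd_below_top_eigval_quotient[OF A X kn] \<open>0 < t\<close> by (intro cInf_lower) auto
  finally show ?thesis .
qed

text \<open>Moving in direction \<open>a A + X\<close> is rescaling combined with moving in
  direction \<open>X\<close>: \<open>A + t (a A + X) = r (A + g(t) X)\<close> with
  \<open>r = 1 + t a\<close> and \<open>g(t) = t / r\<close>. Homogeneity pulls out
  \<open>r\<close>.\<close>

lemma sum_delta_add_base:
  assumes A: "A \<in> carrier_mat n n" "hermitian_mat A" and X: "X \<in> carrier_mat n n" "hermitian_mat X"
    and k: "k \<in> {1..n}" and a: "0 \<le> a"
  shows "(\<Sum>j<k. delta (complex_of_real a \<cdot>\<^sub>m A + X) A $ j) =
    a * top_eigval_sum k A + (\<Sum>j<k. delta X A $ j)"
proof (rule sum_delta_eqI[OF A _ _ k])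
  define g where "g t = t / (1 + t * a)" for t :: real
  have "((\<lambda>t. t / (1 + t * a)) \<longlongrightarrow> 0 / (1 + 0 * a)) (at_right 0)"
    by (intro tendsto_intros) auto
  \<comment> \<open>\<open>g\<close> stays positive for positive \<open>t\<close>, so the limit of
    the quotients for \<open>X\<close> may be taken along \<open>g\<close>.\<close>
  then have "filterlim g (at_right 0) (at_right 0)"
    using a unfolding g_def
    by (intro tendsto_imp_filterlim_at_right)
      (auto intro!: eventually_mono[OF eventually_at_right_less] divide_pos_pos add_pos_nonneg)
  with delta_tendsto(2)[OF A X k]
  have "((\<lambda>t. top_eigval_quotient k X A (g t)) \<longlongrightarrow> (\<Sum>j<k. delta X A $ j)) (at_right 0)"
    by (rule filterlim_compose)
  then have "((\<lambda>t. a * top_eigval_sum k A + top_eigval_quotient k X A (g t)) \<longlongrightarrow>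
      a * top_eigval_sum k A + (\<Sum>j<k. delta X A $ j)) (at_right 0)"
    by (intro tendsto_intros)
  moreover have "a * top_eigval_sum k A + top_eigval_quotient k X A (g t) =
      top_eigval_quotient k (complex_of_real a \<cdot>\<^sub>m A + X) A t" if "0 < t" for t
  proof -
    define r where "r = 1 + t * a"
    have r: "r > 0" using a that by (simp add: r_def add_pos_nonneg)
    then have t: "t = r * g t" by (simp add: g_def r_def)
    define B where "B = A + complex_of_real (g t) \<cdot>\<^sub>m X"
    have B: "B \<in> carrier_mat n n" "hermitian_mat B"
      unfolding B_def using A X by (auto intro!: hermitian_mat_add hermitian_mat_smult)
    have "complex_of_real t = complex_of_real r * complex_of_real (g t)"
      using t by (metis of_real_mult)
    then have "A + complex_of_real t \<cdot>\<^sub>m (complex_of_real a \<cdot>\<^sub>m A + X) = complex_of_real r \<cdot>\<^sub>m B"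
      unfolding B_def using A X
      by (intro eq_matI; simp add: distrib_left mult.assoc[symmetric]) (simp add: r_def distrib_right)
    then have sum: "top_eigval_sum k (A + complex_of_real t \<cdot>\<^sub>m (complex_of_real a \<cdot>\<^sub>m A + X)) =
        r * top_eigval_sum k B"
      using top_eigval_sum_smult[OF B, of r k] r k by simp
    \<comment> \<open>Since \<open>r / t = 1 / g t\<close> and \<open>(r - 1) / t = a\<close>, the
      quotient splits into the quotient for \<open>X\<close> at \<open>g t\<close> and the constant
      \<open>a * top_eigval_sum k A\<close>.\<close>
    show ?thesis
      unfolding top_eigval_quotient_def B_def[symmetric] sum
      using that r by (simp add: field_simps r_def g_def)
  qed
  then have "\<forall>\<^sub>F t in at_right 0. a * top_eigval_sum k A + top_eigval_quotient k X A (g t) =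
      top_eigval_quotient k (complex_of_real a \<cdot>\<^sub>m A + X) A t"
    by (rule eventually_mono[OF eventually_at_right_less])
  ultimately show "(top_eigval_quotient k (complex_of_real a \<cdot>\<^sub>m A + X) A \<longlongrightarrow>
      a * top_eigval_sum k A + (\<Sum>j<k. delta X A $ j)) (at_right 0)"
    by (rule Lim_transform_eventually)
qed (use A X in \<open>auto intro!: hermitian_mat_add hermitian_mat_smult\<close>)

text \<open>The left-hand side is the derivative at \<open>A\<close> in direction
  \<open>a A + X\<close>. It is at most any difference quotient in that direction, here the one at
  step 1, and this is bounded by subadditivity.\<close>

lemma top_eigval_sum_add_ge:
  assumes A: "A \<in> carrier_mat n n" "hermitian_mat A" and X: "X \<in> carrier_mat n n" "hermitian_mat X"
    and k: "k \<in> {1..n}" and a: "0 \<le> a"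
  shows "a * top_eigval_sum k A + (\<Sum>j<k. delta X A $ j) \<le> top_eigval_sum k (complex_of_real a \<cdot>\<^sub>m A + X)"
proof -
  have C: "complex_of_real a \<cdot>\<^sub>m A + X \<in> carrier_mat n n" "hermitian_mat (complex_of_real a \<cdot>\<^sub>m A + X)"
    using A X by (auto intro!: hermitian_mat_add hermitian_mat_smult)
  have kn: "k \<le> n" using k by simp
  have "(\<Sum>j<k. delta (complex_of_real a \<cdot>\<^sub>m A + X) A $ j)
      \<le> top_eigval_quotient k (complex_of_real a \<cdot>\<^sub>m A + X) A 1"
    by (rule sum_delta_le_quotient[OF A C k]) simp
  also have "\<dots> \<le> top_eigval_sum k (complex_of_real a \<cdot>\<^sub>m A + X)"
    by (rule top_eigval_quotient_le[OF A C kn]) simp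
  finally show ?thesis using sum_delta_add_base[OF A X k a] by simp
qed

text \<open>Along a common ordered eigenbasis the eigenvalue sums are additive, so the difference
  quotient is constant in \<open>t\<close>.\<close>

lemma sum_delta_co_diagonal:
  assumes A: "A \<in> carrier_mat n n" "hermitian_mat A" and B: "B \<in> carrier_mat n n" "hermitian_mat B"
    and U: "eigenbasis_desc n U A" "eigenbasis_desc n U B" and k: "k \<in> {1..n}"
  shows "(\<Sum>j<k. delta B A $ j) = top_eigval_sum k B"
proof (rule sum_delta_eqI[OF A B k])
  have "top_eigval_quotient k B A t = top_eigval_sum k B" if "0 < t" for t
  proof -
    have "A + complex_of_real t \<cdot>\<^sub>m B = complex_of_real 1 \<cdot>\<^sub>m A + complex_of_real t \<cdot>\<^sub>m B"
      using A B by (intro eq_matI) auto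
    then show ?thesis
      using top_eigval_sum_common_eigenbasis[OF A(1) B(1) U, of 1 t k] that k
      by (simp add: top_eigval_quotient_def)
  qed
  then show "(top_eigval_quotient k B A \<longlongrightarrow> top_eigval_sum k B) (at_right 0)"
    by (intro tendsto_eventually eventually_mono[OF eventually_at_right_less]) auto
qed

section \<open>Equivalence of the three weak majorizations\<close>

theorem proposition3:
  fixes n :: nat and A B C :: "complex mat"
  assumes "A \<in> carrier_mat n n" and "B \<in> carrier_mat n n" and "C \<in> carrier_mat n n"
    and "hermitian_mat A" and "hermitian_mat B" and "hermitian_mat C"
    and "co_diagonal A B"
  shows "((\<forall>a::real. a \<ge> 0 \<longrightarrow>
            eigvals_desc (complex_of_real a \<cdot>\<^sub>m A + B)
              \<prec>\<^sub>w eigvals_desc (complex_of_real a \<cdot>\<^sub>m A + C))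
          \<longleftrightarrow> delta B A \<prec>\<^sub>w delta C A)
       \<and> (delta B A \<prec>\<^sub>w delta C A
          \<longleftrightarrow> (\<forall>a::real. a \<ge> 0 \<longrightarrow>
                delta (complex_of_real a \<cdot>\<^sub>m A + B) A
                  \<prec>\<^sub>w delta (complex_of_real a \<cdot>\<^sub>m A + C) A))"
proof -
  note A = assms(1,4) and B = assms(2,5) and C = assms(3,6)
  obtain U where U: "eigenbasis_desc n U A" "eigenbasis_desc n U B"
    using assms(1,7) by (auto simp: co_diagonal_def eigenbasis_desc_def)
  have herm: "complex_of_real a \<cdot>\<^sub>m A + X \<in> carrier_mat n n"
    "hermitian_mat (complex_of_real a \<cdot>\<^sub>m A + X)"
    if "X \<in> carrier_mat n n" "hermitian_mat X" for a X
    using A that by (auto intro!: hermitian_mat_add hermitian_mat_smult)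
  define S where "S k a X = top_eigval_sum k (complex_of_real a \<cdot>\<^sub>m A + X)" for k a X
  define \<Delta> where "\<Delta> k X = (\<Sum>j<k. delta X A $ j)" for k X
  have eig_iff: "eigvals_desc (complex_of_real a \<cdot>\<^sub>m A + B) \<prec>\<^sub>w eigvals_desc (complex_of_real a \<cdot>\<^sub>m A + C)
      \<longleftrightarrow> (\<forall>k\<in>{1..n}. S k a B \<le> S k a C)" for a
    by (simp add: weakly_majorized_def S_def top_eigval_sum_def
        dim_eigvals_desc[OF herm[OF B]] dim_eigvals_desc[OF herm[OF C]])
  have delta_iff: "delta X A \<prec>\<^sub>w delta Y A \<longleftrightarrow> (\<forall>k\<in>{1..n}. \<Delta> k X \<le> \<Delta> k Y)"
    if "X \<in> carrier_mat n n" "hermitian_mat X" "Y \<in> carrier_mat n n" "hermitian_mat Y" for X Y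
    using delta_tendsto(1)[OF A that(1,2)] delta_tendsto(1)[OF A that(3,4)]
    by (simp add: weakly_majorized_def \<Delta>_def)
  \<comment> \<open>For \<open>B\<close> the lower bound that holds for \<open>C\<close> is an
    equality, by additivity on the cone of \<open>A\<close> and \<open>B\<close>.\<close>
  have SB: "S k a B = a * top_eigval_sum k A + \<Delta> k B" if "k \<in> {1..n}" "0 \<le> a" for k a
  proof -
    have "complex_of_real 1 \<cdot>\<^sub>m B = B" using B by (intro eq_matI) auto
    then show ?thesis
      using top_eigval_sum_common_eigenbasis[OF A(1) B(1) U, of a 1 k] that
      by (simp add: S_def \<Delta>_def sum_delta_co_diagonal[OF A B U])
  qed
  have SC: "a * top_eigval_sum k A + \<Delta> k C \<le> S k a C" if "k \<in> {1..n}" "0 \<le> a" for k a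
    unfolding S_def \<Delta>_def by (rule top_eigval_sum_add_ge[OF A C that])
  \<comment> \<open>Scaling the inequality at \<open>a = 1 / t\<close> by \<open>t\<close> bounds
    the quotient of \<open>C\<close> at \<open>t\<close> from below by \<open>\<Delta> k B\<close>,
    which does not depend on \<open>t\<close>; the bound survives the limit.\<close>
  have i_ii: "\<Delta> k B \<le> \<Delta> k C" if le: "\<forall>a\<ge>0. S k a B \<le> S k a C" and k: "k \<in> {1..n}" for k
  proof -
    have "\<Delta> k B \<le> top_eigval_quotient k C A t" if "0 < t" for t
    proof -
      have "complex_of_real t \<cdot>\<^sub>m (complex_of_real (1 / t) \<cdot>\<^sub>m A + C) = A + complex_of_real t \<cdot>\<^sub>m C"
        using A C that by (intro eq_matI) (auto simp: algebra_simps)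
      then have "top_eigval_sum k (A + complex_of_real t \<cdot>\<^sub>m C) = t * S k (1 / t) C"
        using top_eigval_sum_smult[OF herm[OF C], of t k "1 / t"] that k by (simp add: S_def)
      moreover have "S k (1 / t) B \<le> S k (1 / t) C" using le that by simp
      ultimately show ?thesis
        using SB[OF k, of "1 / t"] that by (simp add: top_eigval_quotient_def field_simps)
    qed
    then show ?thesis
      unfolding \<Delta>_def[of k C]
      by (intro tendsto_lowerbound[OF delta_tendsto(2)[OF A C k]])
        (auto intro: eventually_mono[OF eventually_at_right_less])
  qed
  \<comment> \<open>The converse direction is the chain of \<open>SB\<close>, the assumption and
    \<open>SC\<close>.\<close>
  have "(\<forall>a\<ge>0. \<forall>k\<in>{1..n}. S k a B \<le> S k a C) \<longleftrightarrow> (\<forall>k\<in>{1..n}. \<Delta> k B \<le> \<Delta> k C)"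
    using i_ii SB SC by (smt (verit, best))
  moreover have "\<Delta> k (complex_of_real a \<cdot>\<^sub>m A + X) = a * top_eigval_sum k A + \<Delta> k X"
    if "X \<in> carrier_mat n n" "hermitian_mat X" "k \<in> {1..n}" "0 \<le> a" for k a X
    unfolding \<Delta>_def by (rule sum_delta_add_base[OF A that])
  \<comment> \<open>Adding \<open>a A\<close> to the direction adds the same number to both sides,
    so it cancels for each \<open>a\<close>.\<close>
  then have "(\<forall>k\<in>{1..n}. \<Delta> k B \<le> \<Delta> k C) \<longleftrightarrow>
      (\<forall>a\<ge>0. \<forall>k\<in>{1..n}. \<Delta> k (complex_of_real a \<cdot>\<^sub>m A + B) \<le> \<Delta> k (complex_of_real a \<cdot>\<^sub>m A + C))"
    using B C by auto
  ultimately show ?thesis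
    unfolding eig_iff delta_iff[OF B C] delta_iff[OF herm[OF B] herm[OF C]] by blast
qed

end
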